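(* Two random stopping times $\eta_1$ and $\eta_1'$ of Player 1 (each randomized, behavior or mixed, not necessarily of the same type) are game equivalent if and only if they are equivalent.
   Context: $\mathbb{N}=\{1,2,\dots\}$, $I=[0,1]$, $\mathcal{B}$ is the Borel $\sigma$-algebra of $I$, $\lambda$ is Lebesgue measure on $I$. $(\Omega,\mathcal{F},P)$ is a fixed probability space with a filtration $(\mathcal{F}_n)_{n\in\mathbb{N}}$, and $\mathcal{F}=\mathcal{F}_\infty:=\sigma(\mathcal{F}_n,\ n\in\mathbb{N})$. A process $(Y_n)$ is adapted if each $Y_n$ is $\mathcal{F}_n$-measurable (including $n=\infty$ if it is an index). A stopping time is a function $\sigma:\Omega\to\mathbb{N}\cup\{\infty\}$ with $\{\sigma=n\}\in\mathcal{F}_n$ for every $n\in\mathbb{N}\cup\{\infty\}$. There are two players, 1 and 2. A random stopping time $\eta$ is one of the following three types; to each we associate a randomization space $(R_\eta,\mathcal R_\eta,\kappa_\eta)$ and a map $\widetilde N_\eta:R_\eta\times\Omega\to\mathbb{N}\cup\{\infty\}$ (minimum of the empty set is $\infty$). - Randomized stopping time: a nonnegative adapted process $\rho=(\rho_n)_{n\in\mathbb{N}\cup\{\infty\}}$ with $\sum_{n\in\mathbb{N}\cup\{\infty\}}\rho_n(\omega)=1$ for every $\omega$; $(R,\mathcal R,\kappa)=(I,\mathcal{B},\lambda)$, $\widetilde N_\rho(r,\omega)=\min\{n\in\mathbb{N}:\sum_{j=1}^n\rho_j(\omega)\ge r\}$. - Behavior stopping time: an adapted $[0,1]$-valued process $\beta=(\beta_n)_{n\in\mathbb{N}}$;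 $(R,\mathcal R,\kappa)=(I^{\mathbb{N}},\mathcal{B}^{\mathbb{N}},\lambda^{\mathbb{N}})$, $\widetilde N_\beta((r_n)_n,\omega)=\min\{n\in\mathbb{N}:r_n\le\beta_n(\omega)\}$. - Mixed stopping time: a $(\mathcal{B}\times\mathcal{F})$-measurable $\mu:I\times\Omega\to\mathbb{N}\cup\{\infty\}$ with $\mu(r,\cdot)$ a stopping time for every $r\in I$; $(R,\mathcal R,\kappa)=(I,\mathcal{B},\lambda)$, $\widetilde N_\mu=\mu$. The detailed distribution of $\eta$ is the probability measure on $\Omega\times(\mathbb{N}\cup\{\infty\})$ given by $\mathbf{P}_\eta(A\times\{n\})=(\kappa_\eta\otimes P)(\{(r,\omega):\omega\in A,\ \widetilde N_\eta(r,\omega)=n\})$, $A\in\mathcal{F}$. Two random stopping times are equivalent if they have the same detailed distribution. The detailed distribution of a pair $(\eta_1,\eta_2)$ of random stopping times of Players 1 and 2 (the players randomize independently) is the probability measure on $\Omega\times(\mathbb{N}\cup\{\infty\})\times(\mathbb{N}\cup\{\infty\})$ given by $$\mathbf{P}_{\eta_1,\eta_2}(A\times\{n_1\}\times\{n_2\})=(\kappa_{\eta_1}\otimes\kappa_{\eta_2}\otimes P)(\{(r_1,r_2,\omega):\omega\in A,\ \widetilde N_{\eta_1}(r_1,\omega)=n_1,\ \widetilde N_{\eta_2}(r_2,\omega)=n_2\}).$$ Two random stopping times $\eta_1,\eta_1'$ of Player 1 are game equivalent if $\mathbf{P}_{\eta_1,\eta_2}=\mathbf{P}_{\eta_1',\eta_2}$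 for every random stopping time $\eta_2$ (of any type) of Player 2. *)

theory Defs
  imports "HOL-Probability.Probability"
begin

text \<open>
  Time runs through \<open>{1, 2, \<dots>} \<union> {\<infinity>}\<close>, which is the set \<open>{1..}\<close> of type \<^typ>\<open>enat\<close>.  Filtrations,
  processes and stopping times are total functions whose values at time \<open>0\<close> are never used.
\<close>

locale filtered_prob_space = prob_space M
  for M :: "'w measure" and F :: "enat \<Rightarrow> 'w measure" +
  assumes filtration_F: "filtration (space M) (\<lambda>k::nat. F (enat (Suc k)))"
    and space_F_infinity: "space (F \<infinity>) = space M"
    and sets_F_infinity: "sets (F \<infinity>) = sigma_sets (space M) (\<Union>n\<in>{1::nat..}. sets (F (enat n)))"
    and sets_eq_F_infinity: "sets M = sets (F \<infinity>)"

definition is_stopping_time :: "'w measure \<Rightarrow> (enat \<Rightarrow> 'w measure) \<Rightarrow> ('w \<Rightarrow> enat) \<Rightarrow> bool" where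
  "is_stopping_time M F \<sigma> \<longleftrightarrow>
     (\<forall>\<omega>\<in>space M. \<sigma> \<omega> \<in> {1..}) \<and> (\<forall>n\<in>{1..}. {\<omega> \<in> space M. \<sigma> \<omega> = n} \<in> sets (F n))"

definition unit_interval :: "real measure" where
  "unit_interval = restrict_space lborel {0..1}"

datatype 'w random_time =
    Randomized "enat \<Rightarrow> 'w \<Rightarrow> real"
  | Behavior "nat \<Rightarrow> 'w \<Rightarrow> real"
  | Mixed "real \<Rightarrow> 'w \<Rightarrow> enat"

fun random_stopping_time :: "'w measure \<Rightarrow> (enat \<Rightarrow> 'w measure) \<Rightarrow> 'w random_time \<Rightarrow> bool" where
  "random_stopping_time M F (Randomized \<rho>) \<longleftrightarrow>
     (\<forall>n\<in>{1..}. \<rho> n \<in> borel_measurable (F n)) \<and>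
     (\<forall>\<omega>\<in>space M. (\<forall>n\<in>{1..}. 0 \<le> \<rho> n \<omega>) \<and> ((\<lambda>n. \<rho> n \<omega>) has_sum 1) {1..})"
| "random_stopping_time M F (Behavior \<beta>) \<longleftrightarrow>
     (\<forall>n\<in>{1..}. \<beta> n \<in> borel_measurable (F (enat n)) \<and> (\<forall>\<omega>\<in>space M. \<beta> n \<omega> \<in> {0..1}))"
| "random_stopping_time M F (Mixed \<mu>) \<longleftrightarrow>
     (\<lambda>(r, \<omega>). \<mu> r \<omega>) \<in> unit_interval \<Otimes>\<^sub>M M \<rightarrow>\<^sub>M count_space {1..} \<and>
     (\<forall>r\<in>{0..1}. is_stopping_time M F (\<mu> r))"

text \<open>
  The randomization space is \<open>[0,1]\<close> or \<open>[0,1]\<^sup>\<nat>\<close>, depending on the kind of random time.  So that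
  all randomization spaces have the same type, \<open>[0,1]\<close> is embedded by \<^const>\<open>Inl\<close> and \<open>[0,1]\<^sup>\<nat>\<close> by \<^const>\<open>Inr\<close>.
\<close>

fun randomization_space :: "'w random_time \<Rightarrow> (real + (nat \<Rightarrow> real)) measure" where
  "randomization_space (Randomized \<rho>) = embed_measure unit_interval Inl"
| "randomization_space (Behavior \<beta>) = embed_measure (\<Pi>\<^sub>M n\<in>{1..}. unit_interval) Inr"
| "randomization_space (Mixed \<mu>) = embed_measure unit_interval Inl"

text \<open>In \<^typ>\<open>enat\<close>, the infimum of a nonempty set is its minimum, and \<open>Inf {} = \<infinity>\<close>.\<close>

fun realized_time :: "'w random_time \<Rightarrow> real + (nat \<Rightarrow> real) \<Rightarrow> 'w \<Rightarrow> enat" where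
  "realized_time (Randomized \<rho>) r \<omega> = Inf {enat n | n. 1 \<le> n \<and> (\<Sum>j=1..n. \<rho> (enat j) \<omega>) \<ge> projl r}"
| "realized_time (Behavior \<beta>) r \<omega> = Inf {enat n | n. 1 \<le> n \<and> projr r n \<le> \<beta> n \<omega>}"
| "realized_time (Mixed \<mu>) r \<omega> = \<mu> (projl r) \<omega>"

definition detailed_distribution :: "'w measure \<Rightarrow> 'w random_time \<Rightarrow> ('w \<times> enat) measure" where
  "detailed_distribution M \<eta> =
     distr (randomization_space \<eta> \<Otimes>\<^sub>M M) (M \<Otimes>\<^sub>M count_space {1..})
       (\<lambda>(r, \<omega>). (\<omega>, realized_time \<eta> r \<omega>))"

definition equivalent :: "'w measure \<Rightarrow> 'w random_time \<Rightarrow> 'w random_time \<Rightarrow> bool" where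
  "equivalent M \<eta> \<eta>' \<longleftrightarrow> detailed_distribution M \<eta> = detailed_distribution M \<eta>'"

definition pair_detailed_distribution ::
    "'w measure \<Rightarrow> 'w random_time \<Rightarrow> 'w random_time \<Rightarrow> ('w \<times> enat \<times> enat) measure" where
  "pair_detailed_distribution M \<eta>\<^sub>1 \<eta>\<^sub>2 =
     distr (randomization_space \<eta>\<^sub>1 \<Otimes>\<^sub>M randomization_space \<eta>\<^sub>2 \<Otimes>\<^sub>M M)
       (M \<Otimes>\<^sub>M count_space {1..} \<Otimes>\<^sub>M count_space {1..})
       (\<lambda>(r\<^sub>1, r\<^sub>2, \<omega>). (\<omega>, realized_time \<eta>\<^sub>1 r\<^sub>1 \<omega>, realized_time \<eta>\<^sub>2 r\<^sub>2 \<omega>))"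

definition game_equivalent ::
    "'w measure \<Rightarrow> (enat \<Rightarrow> 'w measure) \<Rightarrow> 'w random_time \<Rightarrow> 'w random_time \<Rightarrow> bool" where
  "game_equivalent M F \<eta>\<^sub>1 \<eta>\<^sub>1' \<longleftrightarrow>
     (\<forall>\<eta>\<^sub>2. random_stopping_time M F \<eta>\<^sub>2 \<longrightarrow>
        pair_detailed_distribution M \<eta>\<^sub>1 \<eta>\<^sub>2 = pair_detailed_distribution M \<eta>\<^sub>1' \<eta>\<^sub>2)"

text \<open>
  The image measures above have the values on rectangles by which detailed distributions are
  specified; in particular the maps involved are measurable.  These rectangles determine the measures, because
  the sets of times are countable.
\<close>

lemma Inf_times_eq_enat_iff:
  "Inf {enat n | n. 1 \<le> n \<and> P n} = enat m \<longleftrightarrow> 1 \<le> m \<and> P m \<and> (\<forall>k<m. 1 \<le> k \<longrightarrow> \<not> P k)" (is "?L \<longleftrightarrow> ?R")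
proof
  let ?S = "{enat n | n. 1 \<le> n \<and> P n}"
  assume L: ?L
  then have ne: "?S \<noteq> {}"
    by (metis Inf_enat_def enat.distinct(1))
  then have "Inf ?S \<in> ?S"
    by (metis (mono_tags, lifting) Inf_enat_def LeastI ex_in_conv)
  moreover have "Inf ?S \<le> enat k" if "1 \<le> k" "P k" for k
    using that by (intro Inf_lower) auto
  ultimately show ?R using L by fastforce
next
  assume ?R
  then show ?L
    by (intro antisym Inf_lower Inf_greatest) (auto simp: not_less[symmetric])
qed

lemma Inf_times_eq_infinity_iff:
  "Inf {enat n | n. 1 \<le> n \<and> P n} = \<infinity> \<longleftrightarrow> (\<forall>n\<ge>1. \<not> P n)" (is "?L \<longleftrightarrow> ?R")
proof
  let ?S = "{enat n | n. 1 \<le> n \<and> P n}"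
  assume L: ?L
  have "Inf ?S \<le> enat k" if "1 \<le> k" "P k" for k
    using that by (intro Inf_lower) auto
  then show ?R using L by (metis enat_ord_code(5))
next
  assume ?R
  then have "{enat n | n. 1 \<le> n \<and> P n} = {}" by auto
  then show ?L by (simp add: Inf_enat_def)
qed

lemma measurable_Inf_times:
  assumes "\<And>n::nat. 1 \<le> n \<Longrightarrow> Measurable.pred K (P n)"
  shows "(\<lambda>x. Inf {enat n | n. 1 \<le> n \<and> P n x}) \<in> K \<rightarrow>\<^sub>M count_space {1..}"
proof (subst measurable_count_space_eq_countable)
  show "countable {1::enat..}" by simp
  have ge: "Inf {enat n | n. 1 \<le> n \<and> P n x} \<in> {1..}" for x
    by (auto intro!: Inf_greatest simp: one_enat_def)
  have "(\<lambda>x. Inf {enat n | n. 1 \<le> n \<and> P n x}) -` {a} \<inter> space K \<in> sets K" for a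
  proof (cases a)
    case (enat m)
    have "(\<lambda>x. Inf {enat n | n. 1 \<le> n \<and> P n x}) -` {a} \<inter> space K
      = {x \<in> space K. 1 \<le> m \<and> P m x \<and> (\<forall>k\<in>{1..<m}. \<not> P k x)}"
      using enat Inf_times_eq_enat_iff[of "\<lambda>n. P n _"] by auto
    also have "\<dots> \<in> sets K"
    proof (cases "1 \<le> m")
      case True
      have [measurable]: "Measurable.pred K (P m)" using assms True .
      have "Measurable.pred K (\<lambda>x. \<forall>k\<in>{1..<m}. \<not> P k x)"
        by (intro pred_intros_finite pred_intros_logic assms) auto
      then show ?thesis using True by simp
    qed auto
    finally show ?thesis .
  next
    case infinity
    have "(\<lambda>x. Inf {enat n | n. 1 \<le> n \<and> P n x}) -` {a} \<inter> space K
      = {x \<in> space K. \<forall>n\<in>{1::nat..}. \<not> P n x}"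
      using infinity Inf_times_eq_infinity_iff[of "\<lambda>n. P n _"] by auto
    also have "\<dots> \<in> sets K"
      by (intro predE pred_intros_countable_bounded pred_intros_logic assms) auto
    finally show ?thesis .
  qed
  then show "(\<lambda>x. Inf {enat n | n. 1 \<le> n \<and> P n x}) \<in> space K \<rightarrow> {1..} \<and>
    (\<forall>a\<in>{1..}. (\<lambda>x. Inf {enat n | n. 1 \<le> n \<and> P n x}) -` {a} \<inter> space K \<in> sets K)"
    using ge by auto
qed

lemma measurable_projl_I: "projl \<in> embed_measure unit_interval Inl \<rightarrow>\<^sub>M unit_interval"
  by (intro measurable_embed_measure1) simp

lemma measurable_projr_I:
  "projr \<in> embed_measure (\<Pi>\<^sub>M n\<in>{1::nat..}. unit_interval) Inr \<rightarrow>\<^sub>M (\<Pi>\<^sub>M n\<in>{1..}. unit_interval)"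
  by (intro measurable_embed_measure1) simp

lemma pred_le_borel: "f \<in> borel_measurable K \<Longrightarrow> g \<in> borel_measurable K \<Longrightarrow> Measurable.pred K (\<lambda>x. (f x::real) \<le> g x)"
  unfolding pred_def by (rule borel_measurable_le)

lemma measurable_unit: "f \<in> K \<rightarrow>\<^sub>M unit_interval \<Longrightarrow> f \<in> borel_measurable K"
  unfolding unit_interval_def by (auto dest: measurable_restrict_space2_iff[THEN iffD1])

lemma prob_space_unit: "prob_space unit_interval"
  by (auto simp: unit_interval_def intro!: prob_spaceI simp: emeasure_restrict_space space_restrict_space)

lemma prob_space_randomization: "prob_space (randomization_space \<eta>)"
proof -
  have [simp]: "emeasure unit_interval (space unit_interval) = 1" using prob_space.emeasure_space_1[OF prob_space_unit] .
  interpret product_prob_space "\<lambda>_. unit_interval" "{1::nat..}"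
    using prob_space_unit by (intro product_prob_spaceI)
  have "emeasure (\<Pi>\<^sub>M n\<in>{1::nat..}. unit_interval) (space (\<Pi>\<^sub>M n\<in>{1::nat..}. unit_interval)) = 1" using P.emeasure_space_1 .
  then show ?thesis
  by (cases \<eta>) (auto intro!: prob_spaceI simp: space_embed_measure emeasure_embed_measure_image)
qed

context filtered_prob_space
begin

lemma subalgebra_F:
  assumes "1 \<le> n" shows "subalgebra M (F n)"
proof (cases n)
  case (enat m)
  then obtain k where k: "n = enat (Suc k)"
    using assms by (cases m) (auto simp: one_enat_def)
  have "sets (F n) \<subseteq> sets M"
    unfolding sets_eq_F_infinity sets_F_infinity k by (auto intro!: sigma_sets.Basic bexI[of _ "Suc k"])
  then show ?thesis
    using filtration.space_F[OF filtration_F, of k] k by (simp add: subalgebra_def)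
next
  case infinity
  then show ?thesis by (simp add: subalgebra_def space_F_infinity sets_eq_F_infinity)
qed

lemma measurable_realized_time:
  assumes "random_stopping_time M F \<eta>"
  shows "(\<lambda>(r, \<omega>). realized_time \<eta> r \<omega>) \<in> randomization_space \<eta> \<Otimes>\<^sub>M M \<rightarrow>\<^sub>M count_space {1..}"
proof (cases \<eta>)
  case (Randomized \<rho>)
  have [measurable]: "projl \<in> borel_measurable (embed_measure unit_interval Inl)"
    by (intro measurable_unit measurable_projl_I)
  have \<rho>: "\<rho> (enat n) \<in> borel_measurable M" if "1 \<le> n" for n
    using assms Randomized that by (intro measurable_from_subalg[OF subalgebra_F[of "enat n"]])
      (auto simp: one_enat_def)
  have [measurable]: "(\<lambda>\<omega>. \<Sum>j=1..n. \<rho> (enat j) \<omega>) \<in> borel_measurable M" for n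
    by (intro borel_measurable_sum \<rho>) auto
  show ?thesis
    unfolding Randomized randomization_space.simps realized_time.simps split_beta
    by (intro measurable_Inf_times) measurable
next
  case (Behavior \<beta>)
  have \<beta>: "\<beta> n \<in> borel_measurable M" if "1 \<le> n" for n
    using assms Behavior that by (intro measurable_from_subalg[OF subalgebra_F[of "enat n"]])
      (auto simp: one_enat_def)
  have r: "(\<lambda>r. projr r n) \<in> borel_measurable (embed_measure (\<Pi>\<^sub>M n\<in>{1::nat..}. unit_interval) Inr)" if "1 \<le> n" for n
    using that by (intro measurable_unit measurable_compose[OF measurable_projr_I] measurable_component_singleton) auto
  show ?thesis
    unfolding Behavior randomization_space.simps realized_time.simps split_beta
    by (intro measurable_Inf_times pred_le_borel
       measurable_compose[OF measurable_fst r] measurable_compose[OF measurable_snd \<beta>])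
next
  case (Mixed \<mu>)
  have "(\<lambda>x. (projl (fst x), snd x)) \<in> embed_measure unit_interval Inl \<Otimes>\<^sub>M M \<rightarrow>\<^sub>M unit_interval \<Otimes>\<^sub>M M"
    by (intro measurable_Pair measurable_compose[OF measurable_fst measurable_projl_I] measurable_snd)
  from measurable_compose[OF this, of "\<lambda>(r,\<omega>). \<mu> r \<omega>"] assms Mixed show ?thesis
    by (auto simp: case_prod_unfold)
qed

lemma emeasure_detailed_distribution:
  assumes "random_stopping_time M F \<eta>" and "A \<in> sets M" and "n \<in> {1..}"
  shows "emeasure (detailed_distribution M \<eta>) (A \<times> {n}) =
    emeasure (randomization_space \<eta> \<Otimes>\<^sub>M M)
      {(r, \<omega>). r \<in> space (randomization_space \<eta>) \<and> \<omega> \<in> A \<and> realized_time \<eta> r \<omega> = n}"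
proof -
  note [measurable] = measurable_realized_time[OF assms(1)]
  have "(\<lambda>(r, \<omega>). (\<omega>, realized_time \<eta> r \<omega>)) \<in> randomization_space \<eta> \<Otimes>\<^sub>M M \<rightarrow>\<^sub>M M \<Otimes>\<^sub>M count_space {1..}"
    using measurable_Pair[OF measurable_snd measurable_realized_time[OF assms(1)]] by (simp add: split_beta)
  then show ?thesis unfolding detailed_distribution_def
    using assms sets.sets_into_space[OF assms(2)]
    by (subst emeasure_distr) (auto intro!: arg_cong2[where f=emeasure] simp: space_pair_measure)
qed

lemma emeasure_pair_detailed_distribution:
  assumes 1: "random_stopping_time M F \<eta>\<^sub>1" and 2: "random_stopping_time M F \<eta>\<^sub>2"
    and "A \<in> sets M" and "n1 \<in> {1..}" "n2 \<in> {1..}"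
  shows "emeasure (pair_detailed_distribution M \<eta>\<^sub>1 \<eta>\<^sub>2) (A \<times> {n1} \<times> {n2}) =
    emeasure (randomization_space \<eta>\<^sub>1 \<Otimes>\<^sub>M randomization_space \<eta>\<^sub>2 \<Otimes>\<^sub>M M)
      {(r, s, \<omega>). r \<in> space (randomization_space \<eta>\<^sub>1) \<and> s \<in> space (randomization_space \<eta>\<^sub>2) \<and>
        \<omega> \<in> A \<and> realized_time \<eta>\<^sub>1 r \<omega> = n1 \<and> realized_time \<eta>\<^sub>2 s \<omega> = n2}"
proof -
  let ?K = "randomization_space \<eta>\<^sub>1 \<Otimes>\<^sub>M randomization_space \<eta>\<^sub>2 \<Otimes>\<^sub>M M"
  have a: "(\<lambda>x. (fst x, snd (snd x))) \<in> ?K \<rightarrow>\<^sub>M randomization_space \<eta>\<^sub>1 \<Otimes>\<^sub>M M" by measurable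
  have "(\<lambda>x. (snd (snd x), realized_time \<eta>\<^sub>1 (fst x) (snd (snd x)), realized_time \<eta>\<^sub>2 (fst (snd x)) (snd (snd x))))
      \<in> ?K \<rightarrow>\<^sub>M M \<Otimes>\<^sub>M count_space {1..} \<Otimes>\<^sub>M count_space {1..}"
    using measurable_compose[OF a measurable_realized_time[OF 1]]
     measurable_compose[OF measurable_snd measurable_realized_time[OF 2], of "randomization_space \<eta>\<^sub>1"]
    by (intro measurable_Pair) (auto simp: split_beta)
  moreover have "A \<times> {n1} \<times> {n2} \<in> sets (M \<Otimes>\<^sub>M count_space {1..} \<Otimes>\<^sub>M count_space {1..})"
    using assms by (intro pair_measureI) auto
  ultimately show ?thesis unfolding pair_detailed_distribution_def
    using assms sets.sets_into_space[OF assms(3)]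
    by (subst emeasure_distr) (auto intro!: arg_cong2[where f=emeasure] simp: space_pair_measure split_beta)
qed

end

end

theory Submission
  imports Defs
begin

text \<open>
  The law of \<open>\<eta>\<^sub>1\<close> and the law of \<open>(\<eta>\<^sub>1, \<eta>\<^sub>2)\<close> determine each other by recipes that mention only \<open>\<eta>\<^sub>2\<close>.

  For any \<open>\<eta>\<^sub>2\<close>, forgetting the time at which Player 2 stops turns the law of the pair \<open>(\<eta>\<^sub>1, \<eta>\<^sub>2)\<close> into
  the law of \<open>\<eta>\<^sub>1\<close>, because the randomization space of Player 2 has total mass one
  (\<open>detailed_distribution_eq_distr_pair\<close>).  So game equivalence gives equivalence as soon as
  Player 2 has some random stopping time at all, and never stopping is one.

  Conversely, the players randomize independently.  Hence one can draw \<open>(\<omega>, n)\<close> from the law of \<open>\<eta>\<^sub>1\<close>,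
  draw the randomization \<open>s\<close> of Player 2 independently of it, and report \<open>(\<omega>, n, m)\<close>, where \<open>m\<close> is
  the time realized by \<open>\<eta>\<^sub>2\<close> at \<open>(s, \<omega>)\<close>; the result has the law of \<open>(\<eta>\<^sub>1, \<eta>\<^sub>2)\<close>
  (\<open>pair_detailed_distribution_eq_distr\<close>).  Thus \<open>\<eta>\<^sub>1\<close> enters the joint law through its detailed
  distribution alone.  Drawing \<open>s\<close> separately from \<open>(r, \<omega>)\<close> rather than conditioning on \<open>\<omega>\<close>
  avoids any comparison of conditional distributions up to null sets.
\<close>

text \<open>This is Tonelli's theorem for the first two of three factors.\<close>

lemma distr_pair_left_commute:
  assumes "sigma_finite_measure A" "sigma_finite_measure B" "sigma_finite_measure C"
  shows "distr (A \<Otimes>\<^sub>M B \<Otimes>\<^sub>M C) (B \<Otimes>\<^sub>M A \<Otimes>\<^sub>M C) (\<lambda>(a, b, c). (b, a, c)) = B \<Otimes>\<^sub>M A \<Otimes>\<^sub>M C"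
    (is "distr ?K ?L ?f = _")
proof (rule measure_eqI)
  interpret A: sigma_finite_measure A by fact
  interpret B: sigma_finite_measure B by fact
  interpret C: sigma_finite_measure C by fact
  interpret AB: pair_sigma_finite A B ..
  interpret AC: pair_sigma_finite A C ..
  interpret BC: pair_sigma_finite B C ..
  fix X assume "X \<in> sets (distr ?K ?L ?f)"
  then have X[measurable]: "X \<in> sets ?L" by simp
  have f[measurable]: "?f \<in> ?K \<rightarrow>\<^sub>M ?L" by measurable
  have "emeasure (distr ?K ?L ?f) X = (\<integral>\<^sup>+x. indicator X x \<partial>distr ?K ?L ?f)"
    by simp
  also have "\<dots> = (\<integral>\<^sup>+x. indicator X (?f x) \<partial>?K)"
    by (rule nn_integral_distr[OF f]) simp
  also have "\<dots> = (\<integral>\<^sup>+a. \<integral>\<^sup>+y. indicator X (?f (a, y)) \<partial>(B \<Otimes>\<^sub>M C) \<partial>A)"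
    by (rule BC.nn_integral_fst[symmetric]) measurable
  also have "\<dots> = (\<integral>\<^sup>+a. \<integral>\<^sup>+b. \<integral>\<^sup>+c. indicator X (b, a, c) \<partial>C \<partial>B \<partial>A)"
    by (intro nn_integral_cong, subst C.nn_integral_fst[symmetric]) auto
  also have "\<dots> = (\<integral>\<^sup>+b. \<integral>\<^sup>+a. \<integral>\<^sup>+c. indicator X (b, a, c) \<partial>C \<partial>A \<partial>B)"
    by (rule AB.Fubini'[symmetric]) measurable
  also have "\<dots> = (\<integral>\<^sup>+b. \<integral>\<^sup>+z. indicator X (b, z) \<partial>(A \<Otimes>\<^sub>M C) \<partial>B)"
    by (intro nn_integral_cong, subst C.nn_integral_fst[symmetric]) auto
  also have "\<dots> = (\<integral>\<^sup>+x. indicator X x \<partial>?L)"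
    by (rule AC.nn_integral_fst) measurable
  finally show "emeasure (distr ?K ?L ?f) X = emeasure ?L X" by simp
qed simp

context filtered_prob_space
begin

lemma measurable_time_realization:
  assumes "random_stopping_time M F \<eta>"
  shows "(\<lambda>(r, \<omega>). (\<omega>, realized_time \<eta> r \<omega>)) \<in> randomization_space \<eta> \<Otimes>\<^sub>M M \<rightarrow>\<^sub>M M \<Otimes>\<^sub>M count_space {1..}"
  using measurable_Pair[OF measurable_snd measurable_realized_time[OF assms]] by (simp add: case_prod_unfold)

lemma random_stopping_time_never: "random_stopping_time M F (Mixed (\<lambda>_ _. \<infinity>))"
proof -
  have "space M \<in> sets (F \<infinity>)"
    by (metis sets.top space_F_infinity)
  moreover have "{\<omega> \<in> space M. \<infinity> = n} = (if n = \<infinity> then space M else {})" for n :: enat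
    by auto
  ultimately have "\<forall>n\<in>{1..}. {\<omega> \<in> space M. \<infinity> = n} \<in> sets (F n)"
    by (metis sets.empty_sets)
  moreover have "\<infinity> \<in> {1::enat..}" by simp
  ultimately have "is_stopping_time M F (\<lambda>_. \<infinity>)"
    unfolding is_stopping_time_def by blast
  moreover have "(\<lambda>(r, \<omega>). \<infinity>) \<in> unit_interval \<Otimes>\<^sub>M M \<rightarrow>\<^sub>M count_space {1::enat..}"
    unfolding case_prod_unfold by (rule measurable_const) simp
  ultimately show ?thesis
    unfolding random_stopping_time.simps by blast
qed

lemma prob_space_detailed_distribution:
  assumes "random_stopping_time M F \<eta>"
  shows "prob_space (detailed_distribution M \<eta>)"
proof -
  interpret R: prob_space "randomization_space \<eta>" by (rule prob_space_randomization)
  interpret RM: pair_prob_space "randomization_space \<eta>" M ..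
  show ?thesis
    unfolding detailed_distribution_def
    by (rule RM.prob_space_distr[OF measurable_time_realization[OF assms]])
qed

lemma measurable_append_realized_time:
  assumes "random_stopping_time M F \<eta>"
  shows "(\<lambda>(s, \<omega>, n :: enat). (\<omega>, n, realized_time \<eta> s \<omega>))
    \<in> randomization_space \<eta> \<Otimes>\<^sub>M M \<Otimes>\<^sub>M count_space {1..} \<rightarrow>\<^sub>M M \<Otimes>\<^sub>M count_space {1..} \<Otimes>\<^sub>M count_space {1..}"
proof -
  have "(\<lambda>x. (fst x, fst (snd x)))
      \<in> randomization_space \<eta> \<Otimes>\<^sub>M M \<Otimes>\<^sub>M count_space {1::enat..} \<rightarrow>\<^sub>M randomization_space \<eta> \<Otimes>\<^sub>M M"
    by measurable
  from measurable_compose[OF this measurable_realized_time[OF assms]]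
  show ?thesis
    unfolding case_prod_unfold by (intro measurable_Pair) (simp_all add: split_beta)
qed

text \<open>
  The randomizations of the players and \<open>\<omega>\<close> form an independent triple, so \<open>(r, \<omega>)\<close> can be drawn
  and condensed to \<open>(\<omega>, n)\<close> before \<open>s\<close> is appended.
\<close>

lemma pair_detailed_distribution_eq_distr:
  assumes \<eta>\<^sub>1: "random_stopping_time M F \<eta>\<^sub>1" and \<eta>\<^sub>2: "random_stopping_time M F \<eta>\<^sub>2"
  shows "pair_detailed_distribution M \<eta>\<^sub>1 \<eta>\<^sub>2 =
    distr (randomization_space \<eta>\<^sub>2 \<Otimes>\<^sub>M detailed_distribution M \<eta>\<^sub>1)
      (M \<Otimes>\<^sub>M count_space {1..} \<Otimes>\<^sub>M count_space {1..})
      (\<lambda>(s, \<omega>, n). (\<omega>, n, realized_time \<eta>\<^sub>2 s \<omega>))"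
proof -
  let ?R1 = "randomization_space \<eta>\<^sub>1" and ?R2 = "randomization_space \<eta>\<^sub>2"
  let ?N = "count_space {1::enat..}"
  let ?f = "\<lambda>(r, \<omega>). (\<omega>, realized_time \<eta>\<^sub>1 r \<omega>)"
  let ?g = "\<lambda>(s, \<omega>, n). (\<omega>, n, realized_time \<eta>\<^sub>2 s \<omega>)"
  let ?swap = "\<lambda>(r, s, \<omega>). (s, r, \<omega>)"
  interpret R1: prob_space ?R1 by (rule prob_space_randomization)
  interpret R2: prob_space ?R2 by (rule prob_space_randomization)
  have f: "?f \<in> ?R1 \<Otimes>\<^sub>M M \<rightarrow>\<^sub>M M \<Otimes>\<^sub>M ?N"
    by (rule measurable_time_realization[OF \<eta>\<^sub>1])
  have fs: "(\<lambda>(s, x). (s, ?f x)) \<in> ?R2 \<Otimes>\<^sub>M ?R1 \<Otimes>\<^sub>M M \<rightarrow>\<^sub>M ?R2 \<Otimes>\<^sub>M M \<Otimes>\<^sub>M ?N"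
    using measurable_Pair[OF measurable_fst measurable_compose[OF measurable_snd f]]
    by (simp add: case_prod_unfold)
  have g: "?g \<in> ?R2 \<Otimes>\<^sub>M M \<Otimes>\<^sub>M ?N \<rightarrow>\<^sub>M M \<Otimes>\<^sub>M ?N \<Otimes>\<^sub>M ?N"
    by (rule measurable_append_realized_time[OF \<eta>\<^sub>2])
  have swap: "?swap \<in> ?R1 \<Otimes>\<^sub>M ?R2 \<Otimes>\<^sub>M M \<rightarrow>\<^sub>M ?R2 \<Otimes>\<^sub>M ?R1 \<Otimes>\<^sub>M M" by measurable
  have prob: "prob_space (distr (?R1 \<Otimes>\<^sub>M M) (M \<Otimes>\<^sub>M ?N) ?f)"
    using prob_space_detailed_distribution[OF \<eta>\<^sub>1] by (simp add: detailed_distribution_def)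
  have "?R2 \<Otimes>\<^sub>M detailed_distribution M \<eta>\<^sub>1 = distr ?R2 ?R2 (\<lambda>s. s) \<Otimes>\<^sub>M distr (?R1 \<Otimes>\<^sub>M M) (M \<Otimes>\<^sub>M ?N) ?f"
    by (simp add: detailed_distribution_def distr_id2)
  also have "\<dots> = distr (?R2 \<Otimes>\<^sub>M ?R1 \<Otimes>\<^sub>M M) (?R2 \<Otimes>\<^sub>M M \<Otimes>\<^sub>M ?N) (\<lambda>(s, x). (s, ?f x))"
    by (rule pair_measure_distr[OF measurable_ident_sets[OF refl] f])
      (rule prob_space_imp_sigma_finite[OF prob])
  finally have append_law: "?R2 \<Otimes>\<^sub>M detailed_distribution M \<eta>\<^sub>1 = \<dots>" .
  have commute: "distr (?R1 \<Otimes>\<^sub>M ?R2 \<Otimes>\<^sub>M M) (?R2 \<Otimes>\<^sub>M ?R1 \<Otimes>\<^sub>M M) ?swap = ?R2 \<Otimes>\<^sub>M ?R1 \<Otimes>\<^sub>M M"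
    by (rule distr_pair_left_commute) unfold_locales
  have "distr (?R2 \<Otimes>\<^sub>M detailed_distribution M \<eta>\<^sub>1) (M \<Otimes>\<^sub>M ?N \<Otimes>\<^sub>M ?N) ?g =
      distr (?R2 \<Otimes>\<^sub>M ?R1 \<Otimes>\<^sub>M M) (M \<Otimes>\<^sub>M ?N \<Otimes>\<^sub>M ?N) (?g \<circ> (\<lambda>(s, x). (s, ?f x)))"
    unfolding append_law by (rule distr_distr[OF g fs])
  also have "\<dots> = distr (distr (?R1 \<Otimes>\<^sub>M ?R2 \<Otimes>\<^sub>M M) (?R2 \<Otimes>\<^sub>M ?R1 \<Otimes>\<^sub>M M) ?swap)
      (M \<Otimes>\<^sub>M ?N \<Otimes>\<^sub>M ?N) (?g \<circ> (\<lambda>(s, x). (s, ?f x)))"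
    unfolding commute ..
  also have "\<dots> = distr (?R1 \<Otimes>\<^sub>M ?R2 \<Otimes>\<^sub>M M) (M \<Otimes>\<^sub>M ?N \<Otimes>\<^sub>M ?N)
      (?g \<circ> (\<lambda>(s, x). (s, ?f x)) \<circ> ?swap)"
    by (rule distr_distr[OF measurable_comp[OF fs g] swap])
  also have "?g \<circ> (\<lambda>(s, x). (s, ?f x)) \<circ> ?swap =
      (\<lambda>(r, s, \<omega>). (\<omega>, realized_time \<eta>\<^sub>1 r \<omega>, realized_time \<eta>\<^sub>2 s \<omega>))"
    by auto
  finally show ?thesis by (simp add: pair_detailed_distribution_def)
qed

text \<open>
  In the representation of the joint law by \<open>pair_detailed_distribution_eq_distr\<close>, the map leaves
  \<open>(\<omega>, n)\<close> alone, and \<open>s\<close> is drawn from a probability space.  So forgetting \<open>m\<close> is the projection of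
  a product measure onto a factor.
\<close>

lemma detailed_distribution_eq_distr_pair:
  assumes \<eta>\<^sub>1: "random_stopping_time M F \<eta>\<^sub>1" and \<eta>\<^sub>2: "random_stopping_time M F \<eta>\<^sub>2"
  shows "detailed_distribution M \<eta>\<^sub>1 =
    distr (pair_detailed_distribution M \<eta>\<^sub>1 \<eta>\<^sub>2) (M \<Otimes>\<^sub>M count_space {1..}) (\<lambda>(\<omega>, n, m). (\<omega>, n))"
proof -
  let ?D = "detailed_distribution M \<eta>\<^sub>1" and ?R2 = "randomization_space \<eta>\<^sub>2"
  let ?N = "count_space {1::enat..}"
  let ?g = "\<lambda>(s, \<omega>, n). (\<omega>, n, realized_time \<eta>\<^sub>2 s \<omega>)"
  let ?forget = "\<lambda>(\<omega>, n, m). (\<omega>, n)"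
  interpret R2: prob_space ?R2 by (rule prob_space_randomization)
  interpret D: prob_space ?D by (rule prob_space_detailed_distribution[OF \<eta>\<^sub>1])
  interpret R2D: pair_sigma_finite ?R2 ?D ..
  have sets_D: "sets ?D = sets (M \<Otimes>\<^sub>M ?N)"
    by (simp add: detailed_distribution_def)
  have g: "?g \<in> ?R2 \<Otimes>\<^sub>M ?D \<rightarrow>\<^sub>M M \<Otimes>\<^sub>M ?N \<Otimes>\<^sub>M ?N"
    using measurable_append_realized_time[OF \<eta>\<^sub>2]
    by (subst measurable_cong_sets[OF sets_pair_measure_cong[OF refl sets_D] refl])
  have forget: "?forget \<in> M \<Otimes>\<^sub>M ?N \<Otimes>\<^sub>M ?N \<rightarrow>\<^sub>M M \<Otimes>\<^sub>M ?N" by measurable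
  have "distr (pair_detailed_distribution M \<eta>\<^sub>1 \<eta>\<^sub>2) (M \<Otimes>\<^sub>M ?N) ?forget =
      distr (?R2 \<Otimes>\<^sub>M ?D) (M \<Otimes>\<^sub>M ?N) (?forget \<circ> ?g)"
    by (simp add: pair_detailed_distribution_eq_distr[OF \<eta>\<^sub>1 \<eta>\<^sub>2] distr_distr[OF forget g])
  also have "?forget \<circ> ?g = snd" by auto
  also have "distr (?R2 \<Otimes>\<^sub>M ?D) (M \<Otimes>\<^sub>M ?N) snd = distr (?R2 \<Otimes>\<^sub>M ?D) ?D snd"
    by (rule distr_cong) (simp_all add: sets_D)
  also have "\<dots> = distr (distr (?D \<Otimes>\<^sub>M ?R2) (?R2 \<Otimes>\<^sub>M ?D) (\<lambda>(x, s). (s, x))) ?D snd"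
    by (rule arg_cong[where f = "\<lambda>K. distr K ?D snd", OF R2D.distr_pair_swap])
  also have "\<dots> = distr (?D \<Otimes>\<^sub>M ?R2) ?D fst"
    by (simp add: distr_distr comp_def case_prod_unfold)
  also have "\<dots> = ?D" by (rule R2.distr_pair_fst)
  finally show ?thesis ..
qed

end

theorem theorem6:
  fixes M :: "'w measure" and F :: "enat \<Rightarrow> 'w measure" and \<eta>\<^sub>1 \<eta>\<^sub>1' :: "'w random_time"
  assumes "filtered_prob_space M F"
    and "random_stopping_time M F \<eta>\<^sub>1"
    and "random_stopping_time M F \<eta>\<^sub>1'"
  shows "game_equivalent M F \<eta>\<^sub>1 \<eta>\<^sub>1' \<longleftrightarrow> equivalent M \<eta>\<^sub>1 \<eta>\<^sub>1'"
proof -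
  interpret filtered_prob_space M F by fact
  show ?thesis
  proof
    assume "game_equivalent M F \<eta>\<^sub>1 \<eta>\<^sub>1'"
    then have "pair_detailed_distribution M \<eta>\<^sub>1 (Mixed (\<lambda>_ _. \<infinity>)) =
        pair_detailed_distribution M \<eta>\<^sub>1' (Mixed (\<lambda>_ _. \<infinity>))"
      using random_stopping_time_never unfolding game_equivalent_def by blast
    then show "equivalent M \<eta>\<^sub>1 \<eta>\<^sub>1'"
      unfolding equivalent_def
        detailed_distribution_eq_distr_pair[OF assms(2) random_stopping_time_never]
        detailed_distribution_eq_distr_pair[OF assms(3) random_stopping_time_never]
      by (rule arg_cong)
  next
    assume "equivalent M \<eta>\<^sub>1 \<eta>\<^sub>1'"
    then show "game_equivalent M F \<eta>\<^sub>1 \<eta>\<^sub>1'"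
      by (simp add: game_equivalent_def equivalent_def
          pair_detailed_distribution_eq_distr[OF assms(2)]
          pair_detailed_distribution_eq_distr[OF assms(3)])
  qed
qed

end
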